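(* Let $\boldsymbol v\in\mathbb R^3$ with $v:=|\boldsymbol v|<\sqrt2-1$ and let $\lambda\in(0,1]$ satisfy $\lambda\le\frac1{1+v}$. For any given $\mathcal U=(\mathcal N,\mathcal G)\in\mathcal R$ and any initial guess $\mathcal M^{[0]}\in\mathcal R$, the iteration $\mathcal M^{[k+1]}=\mathcal H_{\mathcal U}(\mathcal M^{[k]})$, where $$\mathcal H_{\mathcal U}(\mathcal D,\mathcal I)=\begin{pmatrix}\mathcal D\\ \mathcal I_j\end{pmatrix}-\lambda\begin{pmatrix}\mathcal D+v^i\mathcal I_i-\mathcal N\\ \mathcal I_j+v^i\mathsf k_{ij}(\mathcal D,\mathcal I)\mathcal D-\mathcal G_j\end{pmatrix},$$ converges, as $k\to\infty$, to the unique $\mathcal M=(\mathcal D,\mathcal I)\in\mathcal R$ that satisfies $\mathcal N=\mathcal D+v^i\mathcal I_i$ and $\mathcal G_j=\mathcal I_j+v^i\mathsf k_{ij}(\mathcal M)\mathcal D$, $j=1,2,3$.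
   Context: $\mathcal R=\{(\mathcal D,\mathcal I)\in\mathbb R\times\mathbb R^3:\mathcal D>0,\ |\mathcal I|\le\mathcal D\}$. Repeated indices are summed over $1,2,3$, indices are raised/lowered with $\delta_{ij}$. For $\mathcal M=(\mathcal D,\mathcal I)\in\mathcal R$ let $h=|\mathcal I|/\mathcal D\in[0,1]$, $\hat n=\mathcal I/|\mathcal I|$, and $\mathsf k_{ij}(\mathcal M)=\frac12[(1-\psi(h))\delta_{ij}+(3\psi(h)-1)\hat n_i\hat n_j]$ (so $\mathsf k_{ij}=\delta_{ij}/3$ if $\mathcal I=0$), where $\psi$ is the Eddington factor of the (exact) Minerbo maximum-entropy closure: $\psi(h)=1-2h/\beta(h)$ for $h\in(0,1)$, with $\beta(h)=L^{-1}(h)$, $L(\beta)=\coth\beta-1/\beta$, and $\psi(0)=1/3$, $\psi(1)=1$. *)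

theory Defs
  imports "HOL-Analysis.Analysis"
begin

text \<open>
  A moment pair \<open>M = (D, I)\<close> is an element of \<^typ>\<open>real \<times> (real ^ 3)\<close> (with its Euclidean norm);
  \<open>D\<close> is the zeroth moment and \<open>I\<close> the first moment.
\<close>

definition realizable :: "(real \<times> (real ^ 3)) set" where
  "realizable = {(D, I). D > 0 \<and> norm I \<le> D}"

text \<open>\<open>L \<beta> = coth \<beta> - 1 / \<beta>\<close>, intended for \<open>\<beta> > 0\<close> only.\<close>

definition langevin :: "real \<Rightarrow> real" where
  "langevin \<beta> = cosh \<beta> / sinh \<beta> - 1 / \<beta>"

text \<open>
  The inverse is taken of the restriction of \<^const>\<open>langevin\<close> to \<open>\<beta> > 0\<close>, which is a bijection
  onto the open interval from 0 to 1. It is not specified outside that interval.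
\<close>

definition langevin_inv :: "real \<Rightarrow> real" where
  "langevin_inv = the_inv_into {0<..} langevin"

text \<open>The Eddington factor of the Minerbo closure; only values \<open>0 \<le> h \<le> 1\<close> are meaningful.\<close>

definition eddington :: "real \<Rightarrow> real" where
  "eddington h =
     (if h = 0 then 1 / 3 else if h = 1 then 1 else 1 - 2 * h / langevin_inv h)"

text \<open>
  Since \<^prop>\<open>eddington 0 = 1 / 3\<close>, for \<^prop>\<open>I = 0\<close> the term with \<open>n\<close> vanishes and the value is
  one third of the identity matrix.
\<close>

definition eddington_tensor :: "real \<times> (real ^ 3) \<Rightarrow> real ^ 3 ^ 3" where
  "eddington_tensor = (\<lambda>(D, I).
     let \<psi> = eddington (norm I / D); n = I /\<^sub>R norm I
     in \<chi> i j. ((1 - \<psi>) * (if i = j then 1 else 0) + (3 * \<psi> - 1) * n $ i * n $ j) / 2)"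

definition conserved_moments :: "real ^ 3 \<Rightarrow> real \<times> (real ^ 3) \<Rightarrow> real \<times> (real ^ 3)" where
  "conserved_moments v = (\<lambda>(D, I).
     (D + (\<Sum>i\<in>UNIV. v $ i * I $ i),
      \<chi> j. I $ j + (\<Sum>i\<in>UNIV. v $ i * eddington_tensor (D, I) $ i $ j * D)))"

definition richardson_step ::
  "real ^ 3 \<Rightarrow> real \<Rightarrow> real \<times> (real ^ 3) \<Rightarrow> real \<times> (real ^ 3) \<Rightarrow> real \<times> (real ^ 3)" where
  "richardson_step v lam U M = M - lam *\<^sub>R (conserved_moments v M - U)"

end

theory Submission
  imports Defs
begin

text \<open>
  Write the map to be inverted as \<open>M + flux v M\<close>, where \<open>flux v (D, I) = (v \<bullet> I, D * k v)\<close>. One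
  step of the iteration is then \<open>(1 - lam) * M - lam * flux v M + lam * U\<close>, and two properties of
  the flux give the theorem.

  \<^item> The flux is Lipschitz continuous on the realizable set with constant \<open>(1 + sqrt 2) * norm v\<close>
    in the Euclidean norm (\<open>flux_lipschitz\<close>). Since \<open>(1 + sqrt 2) * (sqrt 2 - 1) = 1\<close>, the condition
    on \<open>norm v\<close> says precisely that this constant is less than 1, which makes the step a contraction.

  \<^item> The combination \<open>(1 - lam) * M - lam * flux v M\<close> stays in the closed cone \<open>norm I \<le> D\<close>
    whenever \<open>lam * norm v \<le> 1 - lam\<close>, that is, \<open>lam \<le> 1 / (1 + norm v)\<close>
    (\<open>weighted_moments_in_cone\<close>). Adding \<open>lam * U\<close> then yields a realizable state with
    \<open>D \<ge> lam * N\<close>, where \<open>N\<close> is the zeroth moment of \<open>U\<close>. The realizable set itself is not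
    closed, but the states satisfying this lower bound form a closed set, on which the Banach fixed
    point theorem applies.

  The second property needs only \<open>h\<^sup>2 \<le> \<psi> \<le> 1\<close> for the Eddington factor \<open>\<psi>\<close>. The first one is a bound
  on the Jacobian of the flux, integrated along segments. The Jacobian depends on the closure
  through \<open>\<psi>'\<close>, \<open>\<psi> - h * \<psi>'\<close> and \<open>(3 * \<psi> - 1) / (2 * h)\<close> only, and the required operator norm
  follows from the bounds 2, 1 and 1 on the absolute values of these three numbers
  (\<open>eddington_derivative_bounds\<close>, \<open>eddington_anisotropy_le\<close>). With \<open>\<psi> = 1 - 2 * L / b\<close> and
  \<open>h = L b\<close> for the Langevin function \<open>L\<close>, whose derivative is \<open>L' = \<psi> - h\<^sup>2\<close>, all of these bounds
  are elementary inequalities between \<open>b\<close>, \<open>L\<close> and \<open>L'\<close>, hence between hyperbolic functions.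

  Segments may touch the boundary of the cone or cross the axis \<open>I = 0\<close>, where the formula
  for the Jacobian does not apply. Boundary and axis are reached by continuity of the flux along
  rays, and a segment that crosses the axis is cut there.
\<close>

section \<open>Hyperbolic inequalities\<close>

text \<open>
  All transcendental inequalities of this development are proved by differentiating until the
  remaining inequality is evident.
\<close>

lemma nonneg_by_derivative:
  fixes f f' :: "real \<Rightarrow> real"
  assumes "\<And>y. 0 \<le> y \<Longrightarrow> (f has_real_derivative f' y) (at y)"
    and "\<And>y. 0 \<le> y \<Longrightarrow> 0 \<le> f' y" and "f 0 = 0" and "0 \<le> x"
  shows "0 \<le> f x"
proof -
  have "f 0 \<le> f x"
    by (rule DERIV_nonneg_imp_nondecreasing[OF assms(4)]) (use assms in blast)
  with assms(3) show ?thesis by simp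
qed

lemma sinh_ge_self:
  fixes x :: real
  assumes "0 \<le> x" shows "x \<le> sinh x"
  by (rule nonneg_by_derivative[of "\<lambda>x. sinh x - x" "\<lambda>x. cosh x - 1" x, unfolded diff_ge_0_iff_ge],
      (auto intro!: derivative_eq_intros)[1],
      use assms cosh_real_ge_1 in simp_all)

lemma cosh_ge_quadratic:
  fixes x :: real
  assumes "0 \<le> x" shows "1 + x^2 / 2 \<le> cosh x"
  by (rule nonneg_by_derivative[of "\<lambda>x. cosh x - (1 + x^2/2)" "\<lambda>x. sinh x - x" x, unfolded diff_ge_0_iff_ge],
      (auto intro!: derivative_eq_intros)[1],
      use assms sinh_ge_self in simp_all)

lemma sinh_ge_cubic:
  fixes x :: real
  assumes "0 \<le> x" shows "x + x^3 / 6 \<le> sinh x"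
  by (rule nonneg_by_derivative[of "\<lambda>x. sinh x - (x + x^3/6)" "\<lambda>x. cosh x - (1 + x^2/2)" x, unfolded diff_ge_0_iff_ge],
      (auto intro!: derivative_eq_intros simp: power2_eq_square field_simps)[1],
      use assms cosh_ge_quadratic in simp_all)

lemma cosh_ge_quartic:
  fixes x :: real
  assumes "0 \<le> x" shows "1 + x^2 / 2 + x^4 / 24 \<le> cosh x"
  by (rule nonneg_by_derivative[of "\<lambda>x. cosh x - (1 + x^2/2 + x^4/24)" "\<lambda>x. sinh x - (x + x^3/6)" x, unfolded diff_ge_0_iff_ge],
      (auto intro!: derivative_eq_intros simp: power2_eq_square power3_eq_cube field_simps)[1],
      use assms sinh_ge_cubic in simp_all)

lemma sinh_le_mult_cosh:
  fixes x :: real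
  assumes "0 \<le> x" shows "sinh x \<le> x * cosh x"
  by (rule nonneg_by_derivative[of "\<lambda>x. x * cosh x - sinh x" "\<lambda>x. x * sinh x" x, unfolded diff_ge_0_iff_ge],
      (auto intro!: derivative_eq_intros)[1],
      use assms in simp_all)

lemma exp_minus_ge_cubic:
  fixes x :: real
  assumes x: "0 \<le> x" shows "1 - x + x^2 / 2 - x^3 / 6 \<le> exp (- x)"
proof -
  have 1: "0 \<le> exp (-x) - 1 + x" if "0 \<le> x" for x :: real
    using exp_ge_add_one_self[of "-x"] by simp
  have 2: "0 \<le> 1 - x + x^2/2 - exp (-x)" if "0 \<le> x" for x :: real
    by (rule nonneg_by_derivative[of "\<lambda>x. 1 - x + x^2/2 - exp (-x)" "\<lambda>x. exp (-x) - 1 + x" x],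
        (auto intro!: derivative_eq_intros)[1],
        use that 1 in simp_all)
  have "0 \<le> exp (-x) - (1 - x + x^2/2 - x^3/6)"
    by (rule nonneg_by_derivative[of "\<lambda>x. exp (-x) - (1 - x + x^2/2 - x^3/6)"
      "\<lambda>x. 1 - x + x^2/2 - exp (-x)" x],
        (auto intro!: derivative_eq_intros simp: power2_eq_square field_simps)[1],
        use x 2 in simp_all)
  then show ?thesis by simp
qed

lemma cosh_double_eq_sinh: "cosh (2 * x) = 1 + 2 * (sinh x)\<^sup>2" for x :: real
  by (simp add: cosh_double cosh_square_eq)

section \<open>The Langevin function\<close>

text \<open>
  The derivative of \<^const>\<open>langevin\<close>, in the form given by its Riccati equation
  \<open>L' = 1 - 2 L / b - L\<^sup>2\<close>. At \<open>b = langevin_inv h\<close> it turns into \<open>eddington h - h\<^sup>2\<close>, so bounds on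
  the Eddington factor and on its derivative become bounds on this function.
\<close>

definition langevin_slope :: "real \<Rightarrow> real" where
  "langevin_slope b = 1 - 2 * langevin b / b - (langevin b)\<^sup>2"

lemma langevin_eq:
  assumes "0 < b"
  shows "langevin b = (b * cosh b - sinh b) / (b * sinh b)"
  using assms by (simp add: langevin_def field_simps)

lemma langevin_slope_eq:
  assumes "0 < b"
  shows "langevin_slope b = 1 / b\<^sup>2 - 1 / (sinh b)\<^sup>2"
proof -
  have nz: "b \<noteq> 0" "sinh b \<noteq> 0" using assms by auto
  have "cosh b / sinh b * (cosh b / sinh b) = (1 + (sinh b)\<^sup>2) / (sinh b)\<^sup>2"
    using cosh_square_eq[of b] by (simp add: power2_eq_square)
  also have "\<dots> = 1 + 1 / (sinh b)\<^sup>2" using nz by (simp add: add_divide_distrib)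
  finally have C: "cosh b / sinh b * (cosh b / sinh b) = 1 + 1 / (sinh b)\<^sup>2" .
  define c where "c = cosh b / sinh b"
  have "langevin_slope b = 1 / b\<^sup>2 + 1 - c * c"
    using nz(1) by (simp add: langevin_slope_def langevin_def power2_eq_square field_simps flip: c_def)
  then show ?thesis using C by (simp add: c_def)
qed

lemma langevin_slope_eq_fraction:
  assumes "0 < b"
  shows "langevin_slope b = ((sinh b)\<^sup>2 - b\<^sup>2) / (b * sinh b)\<^sup>2"
proof -
  have nz: "b \<noteq> 0" "sinh b \<noteq> 0" using assms by auto
  then show ?thesis
    unfolding langevin_slope_eq[OF assms] by (simp add: field_simps power_mult_distrib)
qed

lemma langevin_has_slope:
  assumes "0 < b"
  shows "(langevin has_real_derivative langevin_slope b) (at b)"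
proof -
  have nz: "b \<noteq> 0" "sinh b \<noteq> 0" using assms by auto
  have "((\<lambda>b. cosh b / sinh b - 1 / b) has_real_derivative
      (sinh b * sinh b - cosh b * cosh b) / (sinh b * sinh b) + 1 / (b * b)) (at b)"
    using nz by (auto intro!: derivative_eq_intros)
  moreover have "sinh b * sinh b - cosh b * cosh b = - 1"
    using cosh_square_eq[of b] by (simp add: power2_eq_square)
  ultimately show ?thesis
    unfolding langevin_slope_eq[OF assms] langevin_def[abs_def] by (simp add: power2_eq_square)
qed

lemma langevin_slope_pos:
  assumes "0 < b" shows "0 < langevin_slope b"
proof -
  have "b < b + b^3/6" using assms by simp
  also have "\<dots> \<le> sinh b" using sinh_ge_cubic[of b] assms by simp
  finally have "b < sinh b" .
  then have "b\<^sup>2 < (sinh b)\<^sup>2" using assms by (intro power_strict_mono) auto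
  then show ?thesis using assms by (simp add: langevin_slope_eq_fraction)
qed

lemma langevin_le_third:
  assumes "0 < b" shows "langevin b \<le> b / 3"
proof -
  have "0 \<le> b^2 * sinh b / 3 - b * cosh b + sinh b"
  proof (rule nonneg_by_derivative[of "\<lambda>x. x^2 * sinh x / 3 - x * cosh x + sinh x"
        "\<lambda>x. x * (x * cosh x - sinh x) / 3" b])
    show "((\<lambda>x. x^2 * sinh x / 3 - x * cosh x + sinh x) has_real_derivative
        y * (y * cosh y - sinh y) / 3) (at y)" for y :: real
      by (auto intro!: derivative_eq_intros simp: power2_eq_square field_simps)
    show "0 \<le> y * (y * cosh y - sinh y) / 3" if "0 \<le> y" for y :: real
      using that sinh_le_mult_cosh[of y] by simp
  qed (use assms in auto)
  then show ?thesis using assms by (simp add: langevin_eq field_simps power2_eq_square)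
qed

text \<open>
  Multiplication by \<open>2 * exp b\<close> leaves a polynomial combination of 1 and \<open>exp (2 * b)\<close>. It vanishes
  to third order at 0, and its third derivative is \<open>16 * b * exp (2 * b)\<close>.
\<close>

lemma langevin_ge_rational:
  assumes b: "0 < b" shows "b \<le> langevin b * (b + 3)"
proof -
  have 2: "0 \<le> 4 + (8*x - 4) * exp (2*x)" if "0 \<le> x" for x :: real
    by (rule nonneg_by_derivative[of "\<lambda>x. 4 + (8*x - 4) * exp (2*x)" "\<lambda>x. 16 * x * exp (2*x)" x],
        (auto intro!: derivative_eq_intros simp: algebra_simps)[1],
        use that in simp_all)
  have 1: "0 \<le> 4*x + 4 + (4*x - 4) * exp (2*x)" if "0 \<le> x" for x :: real
    by (rule nonneg_by_derivative[of "\<lambda>x. 4*x + 4 + (4*x - 4) * exp (2*x)"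
        "\<lambda>x. 4 + (8*x - 4) * exp (2*x)" x],
        (auto intro!: derivative_eq_intros simp: algebra_simps)[1],
        use that 2 in simp_all)
  have 0: "0 \<le> 2*b^2 + (2*b - 3) * exp (2*b) + 4*b + 3"
    by (rule nonneg_by_derivative[of "\<lambda>x. 2*x^2 + (2*x - 3) * exp (2*x) + 4*x + 3"
        "\<lambda>x. 4*x + 4 + (4*x - 4) * exp (2*x)" b],
        (auto intro!: derivative_eq_intros simp: algebra_simps)[1],
        use b 1 in simp_all)
  have e: "exp b * exp b = exp (2*b)" "exp b * exp (-b) = 1"
    by (simp_all flip: exp_add)
  have "2 * exp b * ((b * cosh b - sinh b) * (b + 3) - b\<^sup>2 * sinh b)
      = (b * (exp b * (2 * cosh b)) - exp b * (2 * sinh b)) * (b + 3) - b\<^sup>2 * (exp b * (2 * sinh b))"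
    by (simp add: algebra_simps)
  also have "\<dots> = (b * (exp b * exp b + exp b * exp (-b)) - (exp b * exp b - exp b * exp (-b))) * (b + 3)
        - b\<^sup>2 * (exp b * exp b - exp b * exp (-b))"
    unfolding cosh_def sinh_def by (simp add: right_diff_distrib distrib_left)
  also have "\<dots> = 2*b^2 + (2*b - 3) * exp (2*b) + 4*b + 3"
    unfolding e by (simp add: algebra_simps power2_eq_square)
  finally have "2 * exp b * ((b * cosh b - sinh b) * (b + 3) - b\<^sup>2 * sinh b)
      = 2*b^2 + (2*b - 3) * exp (2*b) + 4*b + 3" .
  with 0 have "0 \<le> 2 * exp b * ((b * cosh b - sinh b) * (b + 3) - b\<^sup>2 * sinh b)" by simp
  then have "b\<^sup>2 * sinh b \<le> (b * cosh b - sinh b) * (b + 3)"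
    by (simp add: zero_le_mult_iff)
  then have "b * (b * sinh b) \<le> (b * cosh b - sinh b) * (b + 3)"
    by (simp add: power2_eq_square mult.assoc)
  then have "b \<le> (b * cosh b - sinh b) * (b + 3) / (b * sinh b)"
    using b by (subst pos_le_divide_eq) auto
  then show ?thesis using b by (simp add: langevin_eq)
qed

text \<open>
  In \<open>x = 2 * b\<close> this is \<open>4 * (cosh x - 1) \<le> x * sinh x + x\<^sup>2\<close>, where the Taylor coefficients agree up
  to order four and those on the right are larger from then on. The inequality makes
  \<^const>\<open>eddington\<close> increasing.
\<close>

lemma langevin_slope_upper:
  assumes b: "0 < b" shows "b * langevin_slope b \<le> langevin b"
proof -
  have 2: "0 \<le> x * sinh x / 4 - cosh x / 2 + 1/2" if "0 \<le> x" for x :: real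
    by (rule nonneg_by_derivative[of "\<lambda>x. x * sinh x / 4 - cosh x / 2 + 1/2"
        "\<lambda>x. (x * cosh x - sinh x) / 4" x],
        (auto intro!: derivative_eq_intros simp: field_simps)[1],
        use that sinh_le_mult_cosh in simp_all)
  have 1: "0 \<le> x * cosh x / 4 + x / 2 - 3 * sinh x / 4" if "0 \<le> x" for x :: real
    by (rule nonneg_by_derivative[of "\<lambda>x. x * cosh x / 4 + x / 2 - 3 * sinh x / 4"
        "\<lambda>x. x * sinh x / 4 - cosh x / 2 + 1/2" x],
        (auto intro!: derivative_eq_intros simp: field_simps)[1],
        use that 2 in simp_all)
  have 0: "0 \<le> (2*b) * sinh (2*b) / 4 + (2*b)^2 / 4 - cosh (2*b) + 1"
    by (rule nonneg_by_derivative[of "\<lambda>x. x * sinh x / 4 + x^2 / 4 - cosh x + 1"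
        "\<lambda>x. x * cosh x / 4 + x / 2 - 3 * sinh x / 4" "2*b"],
        (auto intro!: derivative_eq_intros simp: field_simps)[1],
        use b 1 in simp_all)
  have "(sinh b)\<^sup>2 - b\<^sup>2 \<le> (b * cosh b - sinh b) * sinh b"
    using 0 unfolding sinh_double cosh_double_eq_sinh by (simp add: power2_eq_square algebra_simps)
  then have "b * (((sinh b)\<^sup>2 - b\<^sup>2) / (b * sinh b)\<^sup>2) \<le> b * (((b * cosh b - sinh b) * sinh b) / (b * sinh b)\<^sup>2)"
    using b by (intro mult_left_mono divide_right_mono) auto
  also have "\<dots> = langevin b"
    using b by (simp add: langevin_eq power2_eq_square)
  finally show ?thesis using b by (simp add: langevin_slope_eq_fraction)
qed

text \<open>
  This bounds the derivative of \<^const>\<open>eddington\<close> by 2, the value that it approaches at 1. After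
  clearing denominators the two sides agree up to order four at 0; the third-order expansion of
  \<open>exp (- 2 * b)\<close> and the fourth-order expansion of \<open>cosh (2 * b)\<close> are just precise enough.
\<close>

lemma langevin_slope_lower:
  assumes b: "0 < b" shows "langevin b \<le> (b + b\<^sup>2) * langevin_slope b"
proof -
  have e: "1 - exp (- (2*b)) \<le> 2*b - 2*b^2 + 4/3*b^3"
    using exp_minus_ge_cubic[of "2*b"] b by (simp add: power2_eq_square power3_eq_cube field_simps)
  have c: "2*b^2 + 2/3*b^4 \<le> 2 * (sinh b)\<^sup>2"
    using cosh_ge_quartic[of "2*b"] b cosh_double_eq_sinh[of b] by (simp add: field_simps)
  have d: "2 * (cosh b - sinh b) * sinh b = 1 - exp (- (2*b))"
    by (simp add: cosh_minus_sinh) (simp add: sinh_def algebra_simps flip: exp_add)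
  have "b * ((cosh b - sinh b) * sinh b) = b * (1 - exp (- (2*b))) / 2"
    unfolding d[symmetric] by simp
  also have "\<dots> \<le> b * (2*b - 2*b^2 + 4/3*b^3) / 2"
    using e b by (intro divide_right_mono mult_left_mono) auto
  finally have "b * ((cosh b - sinh b) * sinh b) \<le> b * (2*b - 2*b^2 + 4/3*b^3) / 2" .
  then have "(b * cosh b - sinh b) * sinh b \<le> (1 + b) * ((sinh b)\<^sup>2 - b\<^sup>2)"
    using c by (simp add: algebra_simps power2_eq_square power3_eq_cube power4_eq_xxxx)
  then have "b * ((b * cosh b - sinh b) * sinh b / (b * sinh b)\<^sup>2)
     \<le> b * ((1 + b) * ((sinh b)\<^sup>2 - b\<^sup>2) / (b * sinh b)\<^sup>2)"
    using b by (intro mult_left_mono divide_right_mono) auto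
  moreover have "b * ((b * cosh b - sinh b) * sinh b / (b * sinh b)\<^sup>2) = langevin b"
    using b by (simp add: langevin_eq power2_eq_square)
  moreover have "b * ((1 + b) * ((sinh b)\<^sup>2 - b\<^sup>2) / (b * sinh b)\<^sup>2) = (b + b\<^sup>2) * langevin_slope b"
    using b by (simp add: langevin_slope_eq_fraction distrib_left distrib_right power2_eq_square)
  ultimately show ?thesis by simp
qed

text \<open>
  Equivalently \<open>x\<^sup>2 / 2 + x ^ 4 / 8 \<le> x * sinh x - cosh x + 1\<close> for \<open>x = 2 * b\<close>: the power series of
  the right-hand side has nonnegative coefficients and begins with the left-hand side. This is exactly the inequality that
  keeps \<open>eddington h - h * eddington' h\<close> above \<open>-1\<close>.
\<close>

lemma langevin_square_le:
  assumes b: "0 < b" shows "(langevin b)\<^sup>2 \<le> b\<^sup>2 * langevin_slope b"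
proof -
  have "0 \<le> (2*b) * sinh (2*b) - cosh (2*b) + 1 - (2*b)^2/2 - (2*b)^4/8"
  proof (rule nonneg_by_derivative[of "\<lambda>x. x * sinh x - cosh x + 1 - x^2/2 - x^4/8"
        "\<lambda>x. x * (cosh x - (1 + x^2/2))" "2*b"])
    show "((\<lambda>x. x * sinh x - cosh x + 1 - x\<^sup>2 / 2 - x ^ 4 / 8) has_real_derivative
          y * (cosh y - (1 + y\<^sup>2 / 2))) (at y)" for y :: real
      by (auto intro!: derivative_eq_intros simp: field_simps power2_eq_square power3_eq_cube)
    show "0 \<le> y * (cosh y - (1 + y\<^sup>2 / 2))" if "0 \<le> y" for y :: real
      using that cosh_ge_quadratic[of y] by simp
  qed (use b in auto)
  then have *: "0 \<le> 2 * b * (sinh b * cosh b) - (sinh b)\<^sup>2 - b\<^sup>2 - b^4"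
    unfolding sinh_double cosh_double_eq_sinh
    by (simp add: power2_eq_square algebra_simps power4_eq_xxxx)
  have "(b * cosh b - sinh b)\<^sup>2 \<le> b\<^sup>2 * ((sinh b)\<^sup>2 - b\<^sup>2)"
  proof -
    have "(b * cosh b - sinh b)\<^sup>2 = b\<^sup>2 * ((sinh b)\<^sup>2 + 1) - 2 * b * (sinh b * cosh b) + (sinh b)\<^sup>2"
      unfolding cosh_square_eq[symmetric] by (simp add: power2_eq_square algebra_simps)
    with * show ?thesis by (simp add: algebra_simps power2_eq_square power4_eq_xxxx)
  qed
  then have "(b * cosh b - sinh b)\<^sup>2 / (b * sinh b)\<^sup>2 \<le> b\<^sup>2 * ((sinh b)\<^sup>2 - b\<^sup>2) / (b * sinh b)\<^sup>2"
    by (intro divide_right_mono) auto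
  then show ?thesis using b by (simp add: langevin_eq langevin_slope_eq_fraction power_divide)
qed

lemma langevin_less_1:
  assumes "0 < b" shows "langevin b < 1"
proof -
  have "0 < langevin b * (b + 3)"
    using langevin_ge_rational[OF assms] assms by linarith
  then have "0 < langevin b" using assms by (simp add: zero_less_mult_iff)
  then have "0 \<le> 2 * langevin b / b" using assms by simp
  moreover have "(langevin b)\<^sup>2 < 1 - 2 * langevin b / b"
    using langevin_slope_pos[OF assms] by (simp add: langevin_slope_def)
  ultimately have "(langevin b)\<^sup>2 < 1\<^sup>2" by simp
  then show ?thesis by (rule power_less_imp_less_base) simp
qed

lemma langevin_strict_mono:
  assumes "0 < a" "a < b" shows "langevin a < langevin b"
proof (rule DERIV_pos_imp_increasing[OF assms(2)])
  fix x assume "a \<le> x"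
  then have "0 < x" using assms(1) by simp
  then show "\<exists>y. (langevin has_real_derivative y) (at x) \<and> 0 < y"
    using langevin_has_slope langevin_slope_pos by blast
qed

text \<open>
  The bounds \<open>b / (b + 3) \<le> langevin b \<le> b / 3\<close> enclose the preimage of \<open>h\<close> between \<open>h\<close> and
  \<open>3 * h / (1 - h)\<close>.
\<close>

lemma langevin_surj:
  assumes "0 < h" "h < 1" shows "\<exists>b>0. langevin b = h"
proof -
  define a where "a = h"
  define c where "c = 3 * h / (1 - h)"
  have c: "0 < c" "c = h * (c + 3)" 
    using assms by (auto simp: c_def field_simps)
  have "h * 1 \<le> h * (c + 3)" using assms c(1) by (intro mult_left_mono) auto
  then have "a \<le> c" using c(2) by (simp add: a_def)
  have "langevin a \<le> h" using langevin_le_third[of a] assms by (simp add: a_def)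
  moreover have "h \<le> langevin c"
  proof -
    have "h * (c + 3) \<le> langevin c * (c + 3)" using langevin_ge_rational[OF c(1)] c(2) by simp
    then show ?thesis using c(1) by simp
  qed
  moreover have "continuous_on {a..c} langevin"
    using assms by (intro continuous_at_imp_continuous_on ballI DERIV_isCont[OF langevin_has_slope]) (auto simp: a_def)
  ultimately obtain b where "a \<le> b" "b \<le> c" "langevin b = h"
    using IVT'[of langevin a h c] \<open>a \<le> c\<close> by auto
  then show ?thesis using assms a_def by (intro exI[of _ b]) auto
qed

lemma langevin_inv:
  assumes "0 < h" "h < 1"
  shows "0 < langevin_inv h" "langevin (langevin_inv h) = h"
proof -
  have inj: "inj_on langevin {0<..}"
  proof (rule linorder_inj_onI')
    fix a b :: real assume "a \<in> {0<..}" "a < b"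
    then show "langevin a \<noteq> langevin b" using langevin_strict_mono[of a b] by simp
  qed
  have h: "h \<in> langevin ` {0<..}" using langevin_surj[OF assms] by auto
  show "langevin (langevin_inv h) = h"
    using f_the_inv_into_f[OF inj h] by (simp add: langevin_inv_def)
  show "0 < langevin_inv h"
    using the_inv_into_into[OF inj h order_refl] by (simp add: langevin_inv_def)
qed

section \<open>The Eddington factor\<close>

lemma eddington_interior:
  assumes "0 < h" "h < 1" shows "eddington h = 1 - 2 * h / langevin_inv h"
  using assms by (simp add: eddington_def)

lemma langevin_slope_inv:
  assumes "0 < h" "h < 1" shows "langevin_slope (langevin_inv h) = eddington h - h\<^sup>2"
  using assms by (simp add: langevin_slope_def eddington_interior langevin_inv)

text \<open>
  A probability distribution of a cosine with mean \<open>h\<close> has its second moment between \<open>h\<^sup>2\<close> and 1.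
  For the closure, the lower bound is the positivity of \<^const>\<open>langevin_slope\<close>.
\<close>

lemma eddington_realizable:
  assumes "0 \<le> h" "h \<le> 1"
  shows "h\<^sup>2 \<le> eddington h" "eddington h \<le> 1"
proof -
  have "h\<^sup>2 \<le> eddington h \<and> eddington h \<le> 1"
  proof (cases "h = 0 \<or> h = 1")
    case False
    then have h: "0 < h" "h < 1" using assms by auto
    have "0 < eddington h - h\<^sup>2"
      using langevin_slope_pos[OF langevin_inv(1)[OF h]] langevin_slope_inv[OF h] by simp
    moreover have "0 \<le> 2 * h / langevin_inv h" using h langevin_inv[OF h] by simp
    ultimately show ?thesis using eddington_interior[OF h] by simp
  qed (auto simp: eddington_def)
  then show "h\<^sup>2 \<le> eddington h" "eddington h \<le> 1" by auto
qed

text \<open>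
  The quantity \<open>3 * eddington h - 1\<close> multiplies the direction of the first moment, which turns
  infinitely fast at \<open>I = 0\<close>; that it vanishes linearly in \<open>h\<close> compensates for this.
\<close>

lemma eddington_anisotropy_le:
  assumes "0 \<le> h" "h \<le> 1"
  shows "\<bar>3 * eddington h - 1\<bar> \<le> 2 * h"
proof (cases "h = 0 \<or> h = 1")
  case False
  then have h: "0 < h" "h < 1" using assms by auto
  define b where "b = langevin_inv h"
  have b: "0 < b" "langevin b = h" using langevin_inv[OF h] by (auto simp: b_def)
  have e: "3 * eddington h - 1 = 2 - 6 * h / b" using eddington_interior[OF h] by (simp add: b_def)
  have "6 * h / b \<le> 2" using langevin_le_third[OF b(1)] b by (simp add: field_simps)
  moreover have "2 * b \<le> 2 * (h * (b + 3))" using langevin_ge_rational[OF b(1)] b by simp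
  then have "2 \<le> 2 * h + 6 * h / b" using b(1) by (simp add: field_simps)
  ultimately show ?thesis unfolding e by simp
qed (auto simp: eddington_def)

lemma langevin_inv_has_derivative:
  assumes h: "0 < h" "h < 1"
  shows "(langevin_inv has_real_derivative inverse (langevin_slope (langevin_inv h))) (at h)"
proof (rule DERIV_inverse_function[OF langevin_has_slope _ h])
  define b where "b = langevin_inv h"
  have b: "0 < b" "langevin b = h" using langevin_inv[OF h] by (auto simp: b_def)
  have inv: "langevin_inv (langevin z) = z" if "0 < z" for z
  proof -
    have "0 < langevin z" 
    proof -
      have "0 < langevin z * (z + 3)" using langevin_ge_rational[OF that] that by linarith
      then show ?thesis using that by (simp add: zero_less_mult_iff)
    qed
    then have "0 < langevin_inv (langevin z)" "langevin (langevin_inv (langevin z)) = langevin z"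
      using langevin_inv langevin_less_1[OF that] by auto
    then show ?thesis using langevin_strict_mono that by (metis linorder_neqE_linordered_idom less_irrefl)
  qed
  have "isCont langevin_inv (langevin b)"
  proof (rule isCont_inverse_function[where f = langevin and x = b and d = "b/2"])
    fix z assume "\<bar>z - b\<bar> \<le> b / 2"
    then have "0 < z" using b(1) by linarith
    then show "langevin_inv (langevin z) = z" "isCont langevin z"
      using inv DERIV_isCont[OF langevin_has_slope] by auto
  qed (use b in simp)
  then show "isCont langevin_inv h" using b(2) by simp
  show "0 < langevin_inv h" "langevin_slope (langevin_inv h) \<noteq> 0"
    using langevin_slope_pos[of "langevin_inv h"] langevin_inv[OF h] by auto
qed (simp add: langevin_inv)

text \<open>
  The numbers \<open>q\<close> and \<open>eddington h - h * q\<close> are the partial derivatives of the pressure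
  \<open>D * eddington (r / D)\<close> with respect to \<open>r\<close> and to \<open>D\<close>. As \<open>h\<close> tends to 1 they approach 2 and
  \<open>-1\<close>, so that both bounds are attained in the limit.
\<close>

lemma eddington_derivative_bounds:
  assumes h: "0 < h" "h < 1"
  obtains q where "(eddington has_real_derivative q) (at h)"
    and "\<bar>q\<bar> \<le> 2" and "\<bar>eddington h - h * q\<bar> \<le> 1"
proof -
  define b s where "b = langevin_inv h" and "s = langevin_slope b"
  have b: "0 < b" "langevin b = h" using langevin_inv[OF h] by (auto simp: b_def)
  have s: "0 < s" using langevin_slope_pos[OF b(1)] by (simp add: s_def)
  define q where "q = 2 / b * (h / (b * s) - 1)"
  have "((\<lambda>h. 1 - 2 * h / langevin_inv h) has_real_derivative
      - ((2 * b - 2 * h * inverse s) / (b * b))) (at h)"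
    using b(1) by (auto intro!: derivative_eq_intros langevin_inv_has_derivative[OF h] simp flip: b_def s_def)
  moreover have "- ((2 * b - 2 * h * inverse s) / (b * b)) = q"
    using b s by (simp add: q_def field_simps)
  ultimately have d: "((\<lambda>h. 1 - 2 * h / langevin_inv h) has_real_derivative q) (at h)" by simp
  have "(eddington has_real_derivative q) (at h)"
    by (rule has_field_derivative_transform_within_open[OF d, of "{0<..<1}"])
      (use h in \<open>auto simp: eddington_interior\<close>)
  moreover have q: "0 \<le> q" "q \<le> 2"
  proof -
    have "b * s \<le> h" using langevin_slope_upper[OF b(1)] b by (simp add: s_def)
    then have "1 \<le> h / (b * s)" using b s by (subst pos_le_divide_eq) auto
    then show "0 \<le> q" using b unfolding q_def by (intro mult_nonneg_nonneg) auto
    have "h \<le> (b + b\<^sup>2) * s" using langevin_slope_lower[OF b(1)] b by (simp add: s_def)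
    also have "\<dots> = (1 + b) * (b * s)" by (simp add: algebra_simps power2_eq_square)
    finally have "h / (b * s) \<le> 1 + b" using b s by (subst pos_divide_le_eq) auto
    then have "2 / b * (h / (b * s) - 1) \<le> 2 / b * b" using b by (intro mult_left_mono) auto
    then show "q \<le> 2" using b by (simp add: q_def)
  qed
  moreover have "\<bar>eddington h - h * q\<bar> \<le> 1"
  proof -
    have "h\<^sup>2 \<le> b\<^sup>2 * s" using langevin_square_le[OF b(1)] b by (simp add: s_def)
    then have "h\<^sup>2 / (b\<^sup>2 * s) \<le> 1" using b s by (subst pos_divide_le_eq) auto
    moreover have "h * q = 2 * (h\<^sup>2 / (b\<^sup>2 * s)) - 2 * h / b"
      by (simp add: q_def right_diff_distrib power2_eq_square algebra_simps)
    moreover have "eddington h = 1 - 2 * h / b" using eddington_interior[OF h] by (simp add: b_def)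
    moreover have "0 \<le> h * q" using h q by simp
    moreover have "eddington h \<le> 1" using eddington_realizable h by simp
    ultimately show ?thesis by linarith
  qed
  ultimately show thesis using that[of q] by simp
qed

text \<open>
  At 0 and 1, where \<^const>\<open>eddington\<close> has its values by definition, continuity comes from the
  enclosures \<open>\<bar>3 * eddington h - 1\<bar> \<le> 2 * h\<close> and \<open>h\<^sup>2 \<le> eddington h \<le> 1\<close>.
\<close>

lemma eddington_continuous: "continuous_on {0..1} eddington"
proof (rule continuous_on_eq_continuous_within[THEN iffD2], rule ballI)
  fix h :: real assume "h \<in> {0..1}"
  then consider "h = 0" | "h = 1" | "0 < h" "h < 1" by force
  then show "continuous (at h within {0..1}) eddington"
  proof cases
    case 1
    have "((\<lambda>x. eddington x - 1/3) \<longlongrightarrow> 0) (at 0 within {0..1})"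
    proof (rule Lim_null_comparison)
      show "\<forall>\<^sub>F x in at 0 within {0..1}. norm (eddington x - 1/3) \<le> 2 * x / 3"
        unfolding eventually_at_filter
      proof (intro always_eventually allI impI)
        fix x :: real assume "x \<in> {0..1}"
        then have "\<bar>3 * eddington x - 1\<bar> \<le> 2 * x" using eddington_anisotropy_le by simp
        then show "norm (eddington x - 1/3) \<le> 2 * x / 3" unfolding real_norm_def by linarith
      qed
      show "((\<lambda>x. 2 * x / 3 :: real) \<longlongrightarrow> 0) (at 0 within {0..1})"
        by (auto intro!: tendsto_eq_intros)
    qed
    then have "(eddington \<longlongrightarrow> 1/3) (at 0 within {0..1})" by (simp add: Lim_null[symmetric])
    moreover have "1/3 = eddington 0" by (simp add: eddington_def)
    ultimately show ?thesis unfolding 1 continuous_within by metis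
  next
    case 2
    have "(eddington \<longlongrightarrow> 1) (at 1 within {0..1})"
    proof (rule tendsto_sandwich)
      show "\<forall>\<^sub>F x in at 1 within {0..1}. x\<^sup>2 \<le> eddington x" "\<forall>\<^sub>F x in at 1 within {0..1}. eddington x \<le> 1"
        using eddington_realizable by (auto simp: eventually_at_filter intro!: always_eventually)
    qed (auto intro!: tendsto_eq_intros)
    moreover have "eddington 1 = 1" by (simp add: eddington_def)
    ultimately show ?thesis using 2 by (simp add: continuous_within)
  next
    case 3
    then obtain q where "(eddington has_real_derivative q) (at h)"
      using eddington_derivative_bounds by metis
    then show ?thesis by (meson DERIV_isCont continuous_at_imp_continuous_at_within)
  qed
qed

section \<open>The velocity flux\<close>

text \<open>
  The vector \<open>D * v\<^sup>i * k\<^sub>i\<^sub>j\<close>. The function \<^const>\<open>sgn\<close> gives the unit vector of \<open>I\<close> and 0 at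
  \<open>I = 0\<close>, which agrees with the convention in \<^const>\<open>eddington_tensor\<close>.
\<close>

definition stress :: "real ^ 3 \<Rightarrow> real \<Rightarrow> real ^ 3 \<Rightarrow> real ^ 3" where
  "stress v D I = (let \<psi> = eddington (norm I / D); n = sgn I in
     (D * (1 - \<psi>) / 2) *\<^sub>R v + (D * (3 * \<psi> - 1) / 2 * (v \<bullet> n)) *\<^sub>R n)"

text \<open>
  If \<open>M\<close> consists of the moments of an angular density \<open>f\<close>, this is the pair of moments of
  \<open>(v \<bullet> n) * f\<close>.
\<close>

definition flux :: "real ^ 3 \<Rightarrow> real \<times> (real ^ 3) \<Rightarrow> real \<times> (real ^ 3)" where
  "flux v M = (v \<bullet> snd M, stress v (fst M) (snd M))"

lemma conserved_moments_eq: "conserved_moments v M = M + flux v M"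
proof (cases M)
  case (Pair D I)
  define \<psi> n where "\<psi> = eddington (norm I / D)" and "n = sgn I"
  have tensor: "eddington_tensor (D, I) $ i $ j
      = ((1 - \<psi>) * (if i = j then 1 else 0) + (3 * \<psi> - 1) * n $ i * n $ j) / 2" for i j
    by (simp add: eddington_tensor_def Let_def \<psi>_def n_def sgn_div_norm)
  have "(\<Sum>i\<in>UNIV. v $ i * eddington_tensor (D, I) $ i $ j * D) = stress v D I $ j" for j
  proof -
    have "(\<Sum>i\<in>UNIV. v $ i * eddington_tensor (D, I) $ i $ j * D)
        = (\<Sum>i\<in>UNIV. (D * (1 - \<psi>) / 2) * (if i = j then v $ i else 0)
             + (D * (3 * \<psi> - 1) / 2 * n $ j) * (v $ i * n $ i))"
      by (intro sum.cong refl)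
        (simp add: tensor add_divide_distrib diff_divide_distrib algebra_simps)
    also have "\<dots> = (D * (1 - \<psi>) / 2) * v $ j + (D * (3 * \<psi> - 1) / 2 * n $ j) * (v \<bullet> n)"
      unfolding sum.distrib sum_distrib_left[symmetric] by (simp add: inner_vec_def)
    finally show ?thesis
      by (simp add: stress_def Let_def \<psi>_def n_def mult_ac)
  qed
  then show ?thesis
    by (simp add: Pair conserved_moments_def flux_def inner_vec_def vec_eq_iff)
qed

lemma stress_isotropic: "stress v D 0 = (D / 3) *\<^sub>R v"
  by (simp add: stress_def eddington_def)

lemma stress_symmetric: "w \<bullet> stress v D I = v \<bullet> stress w D I"
  by (simp add: stress_def Let_def inner_add_right inner_commute[of w v])

section \<open>Realizability\<close>

text \<open>
  The difference of the two sides is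
  \<open>(1 - c\<^sup>2) * (p - h\<^sup>2) + (1 - p) * ((p - h\<^sup>2) + (h - c)\<^sup>2 + 3 / 4 * (1 - p) * (1 - c\<^sup>2))\<close>.
\<close>

lemma realizability_polynomial:
  fixes h c p :: real
  assumes "h\<^sup>2 \<le> p" "p \<le> 1" "\<bar>c\<bar> \<le> 1"
  shows "(h - (3 * p - 1) / 2 * c)\<^sup>2 - 2 * (h - (3 * p - 1) / 2 * c) * ((1 - p) / 2) * c + ((1 - p) / 2)\<^sup>2
    \<le> (1 - h * c)\<^sup>2"
proof -
  have c: "0 \<le> 1 - c\<^sup>2" using assms(3) by (simp add: abs_square_le_1)
  have "0 \<le> (1 - c\<^sup>2) * (p - h\<^sup>2)" using c assms by simp
  moreover have "0 \<le> (1 - p) * ((p - h\<^sup>2) + (h - c)\<^sup>2 + 3 / 4 * ((1 - p) * (1 - c\<^sup>2)))"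
    using c assms by (intro mult_nonneg_nonneg add_nonneg_nonneg) auto
  ultimately show ?thesis by (simp add: field_simps power2_eq_square)
qed

text \<open>
  If \<open>(D, I)\<close> and the stress are the moments of a density \<open>f \<ge> 0\<close> on the unit sphere, the two sides
  are the norm of the first moment and the zeroth moment of the density \<open>(1 - w \<bullet> n) * f\<close>. The proof
  avoids such a density: decomposed along \<open>w\<close> and the direction of \<open>I\<close>, the claim is the polynomial
  inequality above.
\<close>

lemma stress_moment_bound:
  assumes D: "0 < D" "norm I \<le> D" and w: "norm w = 1"
  shows "norm (I - stress w D I) \<le> D - w \<bullet> I"
proof (cases "I = 0")
  case True
  then show ?thesis using D w by (simp add: stress_isotropic)
next
  case False
  define h n where "h = norm I / D" and "n = sgn I"
  define p c where "p = eddington h" and "c = w \<bullet> n"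
  define x y where "x = h - (3 * p - 1) / 2 * c" and "y = (1 - p) / 2"
  have n: "norm n = 1" using False by (simp add: n_def norm_sgn)
  have I: "I = (D * h) *\<^sub>R n" using D False by (simp add: h_def n_def sgn_div_norm)
  have h: "0 \<le> h" "h \<le> 1" using D by (auto simp: h_def)
  have c: "\<bar>c\<bar> \<le> 1" using Cauchy_Schwarz_ineq2[of w n] n w by (simp add: c_def)
  have nn: "n \<bullet> n = 1" "w \<bullet> w = 1" using n w by (simp_all add: dot_square_norm)
  have "I - stress w D I = D *\<^sub>R (x *\<^sub>R n - y *\<^sub>R w)"
    unfolding stress_def Let_def h_def[symmetric] n_def[symmetric] p_def[symmetric] c_def[symmetric]
    by (subst I) (simp add: x_def y_def algebra_simps diff_divide_distrib add_divide_distrib)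
  moreover have "(norm (x *\<^sub>R n - y *\<^sub>R w))\<^sup>2 \<le> (1 - h * c)\<^sup>2"
  proof -
    have "(norm (x *\<^sub>R n - y *\<^sub>R w))\<^sup>2 = x\<^sup>2 - 2 * x * y * c + y\<^sup>2"
      unfolding power2_norm_eq_inner
      by (simp add: inner_diff_left inner_diff_right nn c_def inner_commute[of n w] power2_eq_square algebra_simps)
    then show ?thesis
      using realizability_polynomial[of h p c] eddington_realizable[OF h] c
      by (simp add: x_def y_def p_def)
  qed
  moreover have "h * c \<le> 1"
  proof -
    have "h * c \<le> \<bar>h * c\<bar>" by simp
    also have "\<dots> \<le> 1 * 1" unfolding abs_mult using h c by (intro mult_mono) auto
    finally show ?thesis by simp
  qed
  ultimately have "norm (I - stress w D I) \<le> D * (1 - h * c)"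
    using D by (auto intro!: power2_le_imp_le)
  also have "\<dots> = D - w \<bullet> I" by (subst I) (simp add: c_def algebra_simps)
  finally show ?thesis .
qed

text \<open>
  The pair on the two sides is the moment vector of \<open>(mu - lam * (v \<bullet> n)) * f\<close>, and the weight is
  nonnegative because \<open>lam * norm v \<le> mu\<close>. In terms of moments: after testing with a unit vector
  \<open>w\<close>, symmetry of the Eddington tensor moves it from \<open>v\<close> to \<open>w\<close>, where \<open>stress_moment_bound\<close> applies.
\<close>

lemma weighted_moments_in_cone:
  assumes D: "0 < D" "norm I \<le> D" and "0 \<le> lam" "lam * norm v \<le> mu"
  shows "norm (mu *\<^sub>R I - lam *\<^sub>R stress v D I) \<le> mu * D - lam * (v \<bullet> I)"
proof -
  define Q where "Q = mu *\<^sub>R I - lam *\<^sub>R stress v D I"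
  have key: "w \<bullet> Q \<le> mu * D - lam * (v \<bullet> I)" if w: "norm w = 1" for w
  proof -
    have "v \<bullet> (I - stress w D I) \<le> norm v * norm (I - stress w D I)"
      by (rule norm_cauchy_schwarz)
    also have "\<dots> \<le> norm v * (D - w \<bullet> I)"
      using stress_moment_bound[OF D w] by (intro mult_left_mono) auto
    finally have "lam * (v \<bullet> (I - stress w D I)) \<le> lam * (norm v * (D - w \<bullet> I))"
      using assms(3) by (rule mult_left_mono)
    also have "\<dots> = (lam * norm v) * (D - w \<bullet> I)" by simp
    also have "\<dots> \<le> mu * (D - w \<bullet> I)"
      using assms(4) stress_moment_bound[OF D w] norm_ge_zero[of "I - stress w D I"]
      by (intro mult_right_mono) linarith+
    finally show ?thesis
      by (simp add: Q_def inner_diff_right stress_symmetric[of w v] algebra_simps)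
  qed
  have "norm Q \<le> mu * D - lam * (v \<bullet> I)"
  proof (cases "Q = 0")
    case True
    then show ?thesis using key[of "axis 1 1"] by (simp add: norm_axis_1)
  next
    case False
    then have "sgn Q \<bullet> Q = norm Q"
      by (simp add: sgn_div_norm dot_square_norm power2_eq_square)
    then show ?thesis using key[of "sgn Q"] False by (simp add: norm_sgn)
  qed
  then show ?thesis by (simp add: Q_def)
qed

section \<open>The Jacobian\<close>

text \<open>
  The squared norm of the Jacobian applied to \<open>(X, Y)\<close>, in coordinates: \<open>a\<close> and \<open>y\<close> are the
  components of \<open>v\<close> and \<open>Y\<close> in the direction \<open>n\<close> of \<open>I\<close>, \<open>s\<close> and \<open>z\<close> are the norms of their parts
  orthogonal to \<open>n\<close>, and \<open>w\<close> is the inner product of these two parts. The number \<open>(1 + sqrt 2)\<^sup>2\<close> is the largest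
  eigenvalue of the quadratic form \<open>y\<^sup>2 + (X + 2 * y)\<^sup>2\<close>, which appears for a unit vector \<open>v\<close>
  parallel to \<open>n\<close> in the extreme case \<open>p = 1\<close>, \<open>q = 2\<close>. All other contributions together need only the constant 5,
  which leaves room for a crude treatment of the mixed term.
\<close>

lemma jacobian_form_bound:
  fixes a s z w X y p q g :: real
  assumes "\<bar>p\<bar> \<le> 1" "\<bar>q\<bar> \<le> 2" "\<bar>g\<bar> \<le> 1" and w: "w\<^sup>2 \<le> s\<^sup>2 * z\<^sup>2"
  defines "P \<equiv> p * X + q * y"
  defines "b \<equiv> (X - P) / 2"
  shows "(a * y + w)\<^sup>2 + ((a * P + g * w)\<^sup>2 + b\<^sup>2 * s\<^sup>2 + 2 * b * (g * a) * w + (g * a)\<^sup>2 * z\<^sup>2)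
    \<le> (1 + sqrt 2)\<^sup>2 * ((a\<^sup>2 + s\<^sup>2) * (X\<^sup>2 + y\<^sup>2 + z\<^sup>2))"
proof -
  define R where "R = X\<^sup>2 + y\<^sup>2"
  define t where "t = (1 + sqrt 2)\<^sup>2"
  define k where "k = y + g * P + g * b"
  have R: "0 \<le> R" by (simp add: R_def)
  have t5: "5 \<le> t"
    using real_le_rsqrt[of 1 2] by (simp add: t_def power2_eq_square algebra_simps)
  have pX: "\<bar>p * X\<bar> \<le> \<bar>X\<bar>" and qy: "\<bar>q * y\<bar> \<le> 2 * \<bar>y\<bar>"
    unfolding abs_mult using assms(1,2) mult_right_mono[of "\<bar>p\<bar>" 1 "\<bar>X\<bar>"] mult_right_mono[of "\<bar>q\<bar>" 2 "\<bar>y\<bar>"]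
    by auto
  have P: "\<bar>P\<bar> \<le> \<bar>X\<bar> + 2 * \<bar>y\<bar>" using pX qy by (simp add: P_def)
  have diag1: "y\<^sup>2 + P\<^sup>2 \<le> t * R"
  proof -
    have "P\<^sup>2 \<le> (\<bar>X\<bar> + 2 * \<bar>y\<bar>)\<^sup>2" using P by (metis abs_ge_zero abs_le_square_iff abs_of_nonneg order_trans)
    \<comment> \<open>This square is the gap between \<open>t * R\<close> and the form \<open>y\<^sup>2 + (\<bar>X\<bar> + 2 * \<bar>y\<bar>)\<^sup>2\<close>: it has rank one because \<open>t\<close> is an eigenvalue of the form.\<close>
    moreover have "0 \<le> 2 * (sqrt 2 - 1) * ((sqrt 2 + 1) * \<bar>X\<bar> - \<bar>y\<bar>)\<^sup>2"
      by (intro mult_nonneg_nonneg) auto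
    ultimately show ?thesis
      by (simp add: R_def t_def power2_eq_square algebra_simps)
  qed
  have bb: "b\<^sup>2 \<le> 2 * R"
  proof -
    have "\<bar>b\<bar> \<le> \<bar>X\<bar> + \<bar>y\<bar>" using P by (simp add: b_def)
    then have "b\<^sup>2 \<le> (\<bar>X\<bar> + \<bar>y\<bar>)\<^sup>2" by (metis abs_ge_zero abs_le_square_iff abs_of_nonneg order_trans)
    also have "\<dots> \<le> 2 * R"
      using zero_le_power2[of "\<bar>X\<bar> - \<bar>y\<bar>"] by (simp add: R_def power2_eq_square algebra_simps)
    finally show ?thesis .
  qed
  \<comment> \<open>The number \<open>k\<close> collects the factors of \<open>2 * a * w\<close> in the expanded squares.\<close>
  have kk: "k\<^sup>2 \<le> 5 * R"
  proof -
    have "\<bar>(X + P) / 2\<bar> \<le> \<bar>X\<bar> + \<bar>y\<bar>" using P by simp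
    then have "\<bar>g\<bar> * \<bar>(X + P) / 2\<bar> \<le> 1 * (\<bar>X\<bar> + \<bar>y\<bar>)" using assms(3) by (intro mult_mono) auto
    moreover have "k = y + g * ((X + P) / 2)" by (simp add: k_def b_def field_simps)
    moreover have "\<bar>y + g * ((X + P) / 2)\<bar> \<le> \<bar>y\<bar> + \<bar>g\<bar> * \<bar>(X + P) / 2\<bar>"
      unfolding abs_mult[symmetric] by (rule abs_triangle_ineq)
    ultimately have "\<bar>k\<bar> \<le> \<bar>X\<bar> + 2 * \<bar>y\<bar>" by simp
    then have "k\<^sup>2 \<le> (\<bar>X\<bar> + 2 * \<bar>y\<bar>)\<^sup>2" by (metis abs_ge_zero abs_le_square_iff abs_of_nonneg order_trans)
    also have "\<dots> \<le> 5 * R"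
      using zero_le_power2[of "2 * \<bar>X\<bar> - \<bar>y\<bar>"] by (simp add: R_def power2_eq_square algebra_simps)
    finally show ?thesis .
  qed
  have cross: "2 * a * w * k \<le> 3 * (s\<^sup>2 * R + a\<^sup>2 * z\<^sup>2)"
  proof (rule power2_le_imp_le)
    have "w\<^sup>2 * k\<^sup>2 \<le> (s\<^sup>2 * z\<^sup>2) * (5 * R)" using w kk by (intro mult_mono) auto
    then have "4 * a\<^sup>2 * (w\<^sup>2 * k\<^sup>2) \<le> 4 * a\<^sup>2 * ((s\<^sup>2 * z\<^sup>2) * (5 * R))" by (intro mult_left_mono) auto
    then have "(2 * a * w * k)\<^sup>2 \<le> 20 * ((s\<^sup>2 * R) * (a\<^sup>2 * z\<^sup>2))"
      by (simp add: power_mult_distrib mult_ac)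
    also have "\<dots> \<le> 36 * ((s\<^sup>2 * R) * (a\<^sup>2 * z\<^sup>2))" using R by (intro mult_right_mono) auto
    also have "\<dots> \<le> (3 * (s\<^sup>2 * R + a\<^sup>2 * z\<^sup>2))\<^sup>2"
      using zero_le_power2[of "s\<^sup>2 * R - a\<^sup>2 * z\<^sup>2"] by (simp add: power2_eq_square algebra_simps)
    finally show "(2 * a * w * k)\<^sup>2 \<le> (3 * (s\<^sup>2 * R + a\<^sup>2 * z\<^sup>2))\<^sup>2" .
  qed (use R in simp)
  have g2: "g\<^sup>2 \<le> 1" using assms(3) by (simp add: abs_square_le_1)
  have gw: "(1 + g\<^sup>2) * w\<^sup>2 \<le> 2 * (s\<^sup>2 * z\<^sup>2)" using g2 w by (intro mult_mono) auto
  have ga: "g\<^sup>2 * (a\<^sup>2 * z\<^sup>2) \<le> 1 * (a\<^sup>2 * z\<^sup>2)" using g2 by (intro mult_right_mono) auto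
  have ay: "a\<^sup>2 * (y\<^sup>2 + P\<^sup>2) \<le> t * (a\<^sup>2 * R)"
    using mult_left_mono[OF diag1, of "a\<^sup>2"] by (simp add: mult_ac)
  have bs: "b\<^sup>2 * s\<^sup>2 \<le> 2 * (s\<^sup>2 * R)"
    using mult_right_mono[OF bb, of "s\<^sup>2"] by (simp add: mult_ac)
  have "(a * y + w)\<^sup>2 + ((a * P + g * w)\<^sup>2 + b\<^sup>2 * s\<^sup>2 + 2 * b * (g * a) * w + (g * a)\<^sup>2 * z\<^sup>2)
    = a\<^sup>2 * (y\<^sup>2 + P\<^sup>2) + b\<^sup>2 * s\<^sup>2 + (1 + g\<^sup>2) * w\<^sup>2 + g\<^sup>2 * (a\<^sup>2 * z\<^sup>2) + 2 * a * w * k"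
    by (simp add: k_def power2_eq_square algebra_simps)
  also have "\<dots> \<le> t * (a\<^sup>2 * R) + 5 * (s\<^sup>2 * R + s\<^sup>2 * z\<^sup>2 + a\<^sup>2 * z\<^sup>2)"
  proof -
    have "0 \<le> a\<^sup>2 * z\<^sup>2" "0 \<le> s\<^sup>2 * z\<^sup>2" by auto
    then show ?thesis using ay bs gw ga cross unfolding distrib_left by linarith
  qed
  also have "\<dots> \<le> t * (a\<^sup>2 * R) + t * (s\<^sup>2 * R + s\<^sup>2 * z\<^sup>2 + a\<^sup>2 * z\<^sup>2)"
    using t5 R by (intro add_left_mono mult_right_mono) auto
  finally show ?thesis by (simp add: t_def R_def algebra_simps)
qed

text \<open>
  The first vector is the derivative of the flux in direction \<open>(X, Y)\<close> at a state whose first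
  moment points along \<open>n\<close>. Here \<open>P\<close> is the derivative of the pressure \<open>D * eddington (norm I / D)\<close>,
  \<open>p\<close> and \<open>q\<close> are its partial derivatives, and \<open>g\<close> is the rate \<open>(3 * \<psi> - 1) / (2 * h)\<close> at which the
  anisotropic part turns with the direction of \<open>I\<close>.
\<close>

lemma jacobian_norm_bound:
  fixes v n Y :: "'a::real_inner" and X p q g :: real
  assumes pqg: "\<bar>p\<bar> \<le> 1" "\<bar>q\<bar> \<le> 2" "\<bar>g\<bar> \<le> 1" and n: "norm n = 1"
  defines "y \<equiv> n \<bullet> Y" and "P \<equiv> p * X + q * (n \<bullet> Y)" and "Z \<equiv> Y - (n \<bullet> Y) *\<^sub>R n"
  shows "norm (v \<bullet> Y, ((X - P) / 2) *\<^sub>R v + ((3 * P - X) / 2 * (v \<bullet> n) + g * (v \<bullet> Z)) *\<^sub>R n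
      + (g * (v \<bullet> n)) *\<^sub>R Z) \<le> (1 + sqrt 2) * norm v * norm (X, Y)"
    (is "norm (_, ?J) \<le> _")
proof (rule power2_le_imp_le)
  define a b where "a = v \<bullet> n" and "b = (X - P) / 2"
  define u where "u = v - a *\<^sub>R n"
  define w where "w = u \<bullet> Z"
  have nn: "n \<bullet> n = 1" using n by (simp add: dot_square_norm)
  have v: "v = a *\<^sub>R n + u" by (simp add: u_def)
  have Y: "Y = y *\<^sub>R n + Z" by (simp add: y_def Z_def)
  have un: "u \<bullet> n = 0" "n \<bullet> u = 0"
    by (simp_all add: u_def a_def nn inner_diff_left inner_diff_right inner_commute[of n v])
  have Zn: "Z \<bullet> n = 0" "n \<bullet> Z = 0"
    by (simp_all add: Z_def nn inner_diff_left inner_diff_right inner_commute[of Y n])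
  have vZ: "v \<bullet> Z = w" by (subst v) (simp add: w_def inner_add_left Zn)
  have vY: "v \<bullet> Y = a * y + w"
    by (subst Y) (simp add: inner_add_right vZ a_def mult.commute)
  have nv: "(norm v)\<^sup>2 = a\<^sup>2 + (norm u)\<^sup>2"
    unfolding power2_norm_eq_inner
    by (subst (1 2) v) (simp add: inner_add_left inner_add_right un nn power2_eq_square)
  have nY: "(norm Y)\<^sup>2 = y\<^sup>2 + (norm Z)\<^sup>2"
    unfolding power2_norm_eq_inner
    by (subst (1 2) Y) (simp add: inner_add_left inner_add_right Zn nn power2_eq_square)
  have J: "?J = (a * P + g * w) *\<^sub>R n + b *\<^sub>R u + (g * a) *\<^sub>R Z"
  proof -
    have c: "(3 * P - X) / 2 * a + g * w = (a * P + g * w) - b * a" by (simp add: b_def field_simps)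
    show ?thesis
      unfolding vZ a_def[symmetric] b_def[symmetric] c by (subst v) (simp add: algebra_simps)
  qed
  have nJ: "(norm ?J)\<^sup>2 = (a * P + g * w)\<^sup>2 + b\<^sup>2 * (norm u)\<^sup>2 + 2 * b * (g * a) * w + (g * a)\<^sup>2 * (norm Z)\<^sup>2"
    unfolding J power2_norm_eq_inner
    by (simp add: inner_add_left inner_add_right un Zn nn w_def inner_commute[of Z u] power2_eq_square algebra_simps)
  have w2: "w\<^sup>2 \<le> (norm u)\<^sup>2 * (norm Z)\<^sup>2"
    using Cauchy_Schwarz_ineq[of u Z] by (simp add: w_def power2_norm_eq_inner)
  have "(norm (v \<bullet> Y, ?J))\<^sup>2 = (a * y + w)\<^sup>2 + (norm ?J)\<^sup>2"
    by (simp add: norm_Pair vY)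
  also have "\<dots> \<le> (1 + sqrt 2)\<^sup>2 * ((a\<^sup>2 + (norm u)\<^sup>2) * (X\<^sup>2 + y\<^sup>2 + (norm Z)\<^sup>2))"
    unfolding nJ unfolding b_def P_def y_def[symmetric] by (rule jacobian_form_bound[OF pqg w2])
  also have "\<dots> = ((1 + sqrt 2) * norm v * norm (X, Y))\<^sup>2"
    by (simp add: power_mult_distrib nv nY norm_Pair add.assoc)
  finally show "(norm (v \<bullet> Y, ?J))\<^sup>2 \<le> ((1 + sqrt 2) * norm v * norm (X, Y))\<^sup>2" .
qed simp

section \<open>Lipschitz continuity of the flux\<close>

lemma flux_derivative_along_line:
  fixes v I Y :: "real ^ 3" and D X t :: real
  assumes pos: "0 < norm (I + t *\<^sub>R Y)" and less: "norm (I + t *\<^sub>R Y) < D + t * X"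
  obtains F where "((\<lambda>t. flux v ((D, I) + t *\<^sub>R (X, Y))) has_vector_derivative F) (at t)"
    and "norm F \<le> (1 + sqrt 2) * norm v * norm (X, Y)"
proof -
  define J E where "J = (\<lambda>t. I + t *\<^sub>R Y)" and "E = (\<lambda>t. D + t * X)"
  define P where "P = (\<lambda>t. E t * eddington (norm (J t) / E t))"
  define r n h where "r = norm (J t)" and "n = sgn (J t)" and "h = r / E t"
  define y Z where "y = n \<bullet> Y" and "Z = Y - (n \<bullet> Y) *\<^sub>R n"
  have J0: "J t \<noteq> 0" and r: "0 < r" and rE: "r < E t"
    using pos less by (auto simp: J_def E_def r_def)
  then have E0: "0 < E t" by linarith
  have h: "0 < h" "h < 1" using r rE by (auto simp: h_def)
  have n: "norm n = 1" using J0 by (simp add: n_def norm_sgn)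
  have Jn: "J t = r *\<^sub>R n" using r by (simp add: r_def n_def sgn_div_norm)
  obtain q where q: "(eddington has_real_derivative q) (at h)" "\<bar>q\<bar> \<le> 2" "\<bar>eddington h - h * q\<bar> \<le> 1"
    using eddington_derivative_bounds[OF h] by blast
  define p g where "p = eddington h - h * q" and "g = (3 * eddington h - 1) / (2 * h)"
  define P' where "P' = p * X + q * y"
  have g: "\<bar>g\<bar> \<le> 1"
  proof -
    have "\<bar>g\<bar> = \<bar>3 * eddington h - 1\<bar> / (2 * h)" using h by (simp add: g_def abs_divide)
    also have "\<dots> \<le> 1" using eddington_anisotropy_le[of h] h by (subst pos_divide_le_eq) auto
    finally show ?thesis .
  qed
  have dE: "(E has_real_derivative X) (at t)"
    unfolding E_def by (auto intro!: derivative_eq_intros)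
  have dJ: "(J has_vector_derivative Y) (at t)"
    unfolding J_def by (auto intro!: derivative_eq_intros)
  have dr: "((\<lambda>t. norm (J t)) has_real_derivative y) (at t)"
  proof -
    have "((\<lambda>t. norm (J t)) has_derivative (\<lambda>s. (s *\<^sub>R Y) \<bullet> sgn (J t))) (at t)"
      using has_derivative_compose[OF dJ[unfolded has_vector_derivative_def] has_derivative_norm[OF J0]] .
    then show ?thesis
      by (simp add: has_real_derivative_iff_has_vector_derivative has_vector_derivative_def y_def n_def
          inner_commute)
  qed
  have dh: "((\<lambda>t. norm (J t) / E t) has_real_derivative (y * E t - r * X) / (E t * E t)) (at t)"
    unfolding r_def by (rule DERIV_divide[OF dr dE]) (use E0 in simp)
  have dP: "(P has_real_derivative P') (at t)"
  proof -
    have "((\<lambda>t. eddington (norm (J t) / E t)) has_real_derivative q * ((y * E t - r * X) / (E t * E t))) (at t)"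
      using DERIV_chain2[OF q(1)[unfolded h_def r_def] dh] .
    from DERIV_mult[OF dE this]
    have "(P has_real_derivative X * eddington h + q * ((y * E t - r * X) / (E t * E t)) * E t) (at t)"
      by (simp add: P_def h_def r_def)
    moreover have "X * eddington h + q * ((y * E t - r * X) / (E t * E t)) * E t = P'"
      using E0 by (simp add: P'_def p_def h_def field_simps)
    ultimately show ?thesis by simp
  qed
  have dn: "((\<lambda>t. sgn (J t)) has_vector_derivative inverse r *\<^sub>R Z) (at t)"
  proof -
    have "((\<lambda>t. inverse (norm (J t))) has_real_derivative - (inverse r * y * inverse r)) (at t)"
      unfolding r_def by (rule DERIV_inverse'[OF dr]) (use J0 in simp)
    from has_vector_derivative_scaleR[OF this dJ]
    have "((\<lambda>t. sgn (J t)) has_vector_derivative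
        inverse (norm (J t)) *\<^sub>R Y + (- (inverse r * y * inverse r)) *\<^sub>R J t) (at t)"
      by (simp add: sgn_div_norm)
    moreover have "inverse (norm (J t)) *\<^sub>R Y + (- (inverse r * y * inverse r)) *\<^sub>R J t = inverse r *\<^sub>R Z"
      using r unfolding Jn Z_def y_def[symmetric] by (simp add: n algebra_simps)
    ultimately show ?thesis by simp
  qed
  have dvn: "((\<lambda>t. v \<bullet> sgn (J t)) has_real_derivative v \<bullet> (inverse r *\<^sub>R Z)) (at t)"
    unfolding has_real_derivative_iff_has_vector_derivative
    by (rule bounded_linear.has_vector_derivative[OF bounded_linear_inner_right dn])
  have dvJ: "((\<lambda>t. v \<bullet> J t) has_vector_derivative v \<bullet> Y) (at t)"
    by (rule bounded_linear.has_vector_derivative[OF bounded_linear_inner_right dJ])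
  let ?S = "((X - P') / 2) *\<^sub>R v + ((3 * P' - X) / 2 * (v \<bullet> n) + g * (v \<bullet> Z)) *\<^sub>R n + (g * (v \<bullet> n)) *\<^sub>R Z"
  have dS: "((\<lambda>t. ((E t - P t) / 2) *\<^sub>R v + ((3 * P t - E t) / 2 * (v \<bullet> sgn (J t))) *\<^sub>R sgn (J t))
      has_vector_derivative ?S) (at t)"
  proof -
    have 1: "((\<lambda>t. (E t - P t) / 2) has_real_derivative (X - P') / 2) (at t)"
      by (intro DERIV_cdivide DERIV_diff dE dP)
    have "((\<lambda>t. (3 * P t - E t) / 2) has_real_derivative (3 * P' - X) / 2) (at t)"
      by (intro DERIV_cdivide DERIV_diff DERIV_cmult dE dP)
    from has_vector_derivative_scaleR[OF DERIV_mult[OF this dvn] dn]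
    have "((\<lambda>t. ((3 * P t - E t) / 2 * (v \<bullet> sgn (J t))) *\<^sub>R sgn (J t)) has_vector_derivative
        ((3 * P t - E t) / 2 * (v \<bullet> n)) *\<^sub>R (inverse r *\<^sub>R Z)
        + ((3 * P' - X) / 2 * (v \<bullet> n) + v \<bullet> (inverse r *\<^sub>R Z) * ((3 * P t - E t) / 2)) *\<^sub>R n) (at t)"
      by (simp only: n_def)
    note d = has_vector_derivative_add[OF has_vector_derivative_scaleR[OF 1 has_vector_derivative_const[of v]] this]
    have gr: "(3 * P t - E t) / 2 * inverse r = g"
      using E0 r h by (simp add: P_def g_def h_def r_def field_simps)
    have e1: "((3 * P t - E t) / 2 * (v \<bullet> n)) *\<^sub>R (inverse r *\<^sub>R Z) = (g * (v \<bullet> n)) *\<^sub>R Z"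
      unfolding gr[symmetric] by simp
    have e2: "v \<bullet> (inverse r *\<^sub>R Z) * ((3 * P t - E t) / 2) = g * (v \<bullet> Z)"
      unfolding gr[symmetric] by simp
    show ?thesis
      using d unfolding e1 e2 scaleR_zero_right by (simp only: add_ac add_0_left)
  qed
  have "(\<lambda>t. flux v ((D, I) + t *\<^sub>R (X, Y))) = (\<lambda>t. (v \<bullet> J t,
      ((E t - P t) / 2) *\<^sub>R v + ((3 * P t - E t) / 2 * (v \<bullet> sgn (J t))) *\<^sub>R sgn (J t)))"
    by (rule ext) (simp add: flux_def stress_def Let_def J_def E_def P_def algebra_simps)
  then have "((\<lambda>t. flux v ((D, I) + t *\<^sub>R (X, Y))) has_vector_derivative (v \<bullet> Y, ?S)) (at t)"
    using has_vector_derivative_Pair[OF dvJ dS] by simp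
  moreover have "norm (v \<bullet> Y, ?S) \<le> (1 + sqrt 2) * norm v * norm (X, Y)"
    using jacobian_norm_bound[OF q(3,2) g n, of v Y X]
    unfolding P'_def y_def Z_def p_def .
  ultimately show thesis by (rule that)
qed

text \<open>
  The Jacobian bound is integrated along the segment between the two states. By strict convexity the
  segment stays inside the open cone, and on it the direction of the first moment is defined.
\<close>

lemma flux_lipschitz_interior:
  fixes I I' :: "real ^ 3"
  assumes less: "norm I < D" "norm I' < D'" and no0: "0 \<notin> closed_segment I I'"
  shows "norm (flux v (D', I') - flux v (D, I)) \<le> (1 + sqrt 2) * norm v * norm ((D', I') - (D, I))"
proof -
  define X Y where "X = D' - D" and "Y = I' - I"
  define f where "f = (\<lambda>t. flux v ((D, I) + t *\<^sub>R (X, Y)))"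
  have ex: "\<exists>F. (f has_vector_derivative F) (at t) \<and> norm F \<le> (1 + sqrt 2) * norm v * norm (X, Y)"
    if t: "0 \<le> t" "t \<le> 1" for t
  proof -
    have eq: "I + t *\<^sub>R Y = (1 - t) *\<^sub>R I + t *\<^sub>R I'" "D + t * X = (1 - t) * D + t * D'"
      by (simp_all add: X_def Y_def algebra_simps)
    have "(1 - t) *\<^sub>R I + t *\<^sub>R I' \<noteq> 0"
      using no0 t unfolding closed_segment_def by (metis (mono_tags, lifting) mem_Collect_eq)
    then have pos: "0 < norm (I + t *\<^sub>R Y)" unfolding eq by simp
    have "norm ((1 - t) *\<^sub>R I + t *\<^sub>R I') \<le> (1 - t) * norm I + t * norm I'"
      using t by (intro norm_triangle_le) auto
    also have "(1 - t) * norm I + t * norm I' < (1 - t) * D + t * D'"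
    proof (cases "t = 1")
      case False
      then show ?thesis using t less by (intro add_less_le_mono mult_strict_left_mono mult_left_mono) auto
    qed (use less in simp)
    finally have "norm (I + t *\<^sub>R Y) < D + t * X" unfolding eq .
    from flux_derivative_along_line[OF pos this, of v] show ?thesis
      unfolding f_def by blast
  qed
  then obtain F where F: "\<And>t. 0 \<le> t \<Longrightarrow> t \<le> 1 \<Longrightarrow> (f has_vector_derivative F t) (at t)"
      "\<And>t. 0 \<le> t \<Longrightarrow> t \<le> 1 \<Longrightarrow> norm (F t) \<le> (1 + sqrt 2) * norm v * norm (X, Y)"
    by metis
  have "continuous_on {0..1} f"
    by (intro continuous_at_imp_continuous_on ballI has_vector_derivative_continuous[OF F(1)]) auto
  then obtain t where t: "t \<in> {0<..<1}" "norm (f 1 - f 0) \<le> norm ((1 - 0) *\<^sub>R F t)"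
    using mvt_general[of 0 1 f "\<lambda>t s. s *\<^sub>R F t"] F(1)[unfolded has_vector_derivative_def] by force
  then have "norm (f 1 - f 0) \<le> (1 + sqrt 2) * norm v * norm (X, Y)"
    using F(2)[of t] by simp
  then show ?thesis by (simp add: f_def X_def Y_def)
qed

text \<open>
  Continuity along these rays suffices to carry the Lipschitz bound to the boundary \<open>norm I = D\<close>
  (as \<open>s\<close> tends to 1) and to the axis \<open>I = 0\<close> (as \<open>s\<close> tends to 0).
\<close>

lemma flux_continuous_along_ray:
  fixes I :: "real ^ 3"
  assumes "0 < D" "norm I \<le> D"
  shows "continuous_on {0..1} (\<lambda>s. flux v (D, s *\<^sub>R I))"
proof -
  define h where "h = norm I / D"
  have h: "0 \<le> h" "h \<le> 1" using assms by (auto simp: h_def)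
  have sh: "s * h \<in> {0..1}" if "s \<in> {0..1}" for s
    using that h mult_mono[of s 1 h 1] by auto
  have "continuous_on {0..1} (\<lambda>s. eddington (s * h))"
    by (rule continuous_on_compose2[OF eddington_continuous])
      (use sh in \<open>auto intro!: continuous_intros\<close>)
  then have cont: "continuous_on {0..1} (\<lambda>s. (v \<bullet> (s *\<^sub>R I), (D * (1 - eddington (s * h)) / 2) *\<^sub>R v
      + (D * (3 * eddington (s * h) - 1) / 2 * (v \<bullet> sgn I)) *\<^sub>R sgn I))"
    by (intro continuous_intros) auto
  have eq: "flux v (D, s *\<^sub>R I) = (v \<bullet> (s *\<^sub>R I), (D * (1 - eddington (s * h)) / 2) *\<^sub>R v
      + (D * (3 * eddington (s * h) - 1) / 2 * (v \<bullet> sgn I)) *\<^sub>R sgn I)" if "s \<in> {0..1}" for s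
  proof (cases "s = 0")
    case True
    then show ?thesis by (simp add: flux_def stress_isotropic eddington_def)
  next
    case False
    then show ?thesis using that by (simp add: flux_def stress_def Let_def h_def sgn_scaleR)
  qed
  show ?thesis by (rule continuous_on_eq[OF cont]) (simp only: eq)
qed

text \<open>
  Shrinking both first moments by the same factor moves the states into the open cone without
  letting the segment between them meet the axis.
\<close>

lemma flux_lipschitz_off_axis:
  fixes I I' :: "real ^ 3"
  assumes R: "norm I \<le> D" "norm I' \<le> D'" and no0: "0 \<notin> closed_segment I I'"
  shows "norm (flux v (D', I') - flux v (D, I)) \<le> (1 + sqrt 2) * norm v * norm ((D', I') - (D, I))"
proof -
  have I0: "I \<noteq> 0" "I' \<noteq> 0" using no0 by auto
  then have D: "0 < D" "0 < D'" using R by (auto intro: less_le_trans[of 0 "norm _"])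
  have bound: "norm (flux v (D', s *\<^sub>R I') - flux v (D, s *\<^sub>R I))
      \<le> (1 + sqrt 2) * norm v * norm ((D', s *\<^sub>R I') - (D, s *\<^sub>R I))" if s: "0 < s" "s < 1" for s
  proof (rule flux_lipschitz_interior)
    show "norm (s *\<^sub>R I) < D" "norm (s *\<^sub>R I') < D'"
      using R less_le_trans[OF mult_strict_right_mono[of s 1 "norm I"], of D]
        less_le_trans[OF mult_strict_right_mono[of s 1 "norm I'"], of D'] s I0
      by simp_all
    show "0 \<notin> closed_segment (s *\<^sub>R I) (s *\<^sub>R I')"
    proof
      assume "0 \<in> closed_segment (s *\<^sub>R I) (s *\<^sub>R I')"
      then obtain u where u: "0 \<le> u" "u \<le> 1" "0 = (1 - u) *\<^sub>R (s *\<^sub>R I) + u *\<^sub>R (s *\<^sub>R I')"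
        unfolding closed_segment_def by blast
      then have "s *\<^sub>R ((1 - u) *\<^sub>R I + u *\<^sub>R I') = 0" by (simp add: scaleR_add_right mult.commute)
      then have "0 = (1 - u) *\<^sub>R I + u *\<^sub>R I'" using s by simp
      then show False using no0 u(1,2) unfolding closed_segment_def by blast
    qed
  qed
  have lim: "((\<lambda>s. flux v (E, s *\<^sub>R J)) \<longlongrightarrow> flux v (E, J)) (at_left 1)"
    if "0 < E" "norm J \<le> E" for E and J :: "real ^ 3"
    using flux_continuous_along_ray[OF that, of v, THEN continuous_on_Icc_at_leftD] by simp
  show ?thesis
  proof (rule tendsto_le)
    show "((\<lambda>s. norm (flux v (D', s *\<^sub>R I') - flux v (D, s *\<^sub>R I)))
        \<longlongrightarrow> norm (flux v (D', I') - flux v (D, I))) (at_left 1)"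
      by (intro tendsto_intros lim D R)
    show "((\<lambda>s. (1 + sqrt 2) * norm v * norm ((D', s *\<^sub>R I') - (D, s *\<^sub>R I)))
        \<longlongrightarrow> (1 + sqrt 2) * norm v * norm ((D', I') - (D, I))) (at_left 1)"
      by (auto intro!: tendsto_eq_intros)
    show "\<forall>\<^sub>F s in at_left 1. norm (flux v (D', s *\<^sub>R I') - flux v (D, s *\<^sub>R I))
        \<le> (1 + sqrt 2) * norm v * norm ((D', s *\<^sub>R I') - (D, s *\<^sub>R I))"
      by (rule eventually_mono[OF eventually_at_left_real[OF zero_less_one]]) (rule bound, auto)
  qed simp
qed

text \<open>
  The point \<open>(E, 0)\<close> is approached along the direction of \<open>I\<close>, so that the segments joining the
  approximations to \<open>(D, I)\<close> avoid the axis.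
\<close>

lemma flux_lipschitz_to_axis:
  fixes I :: "real ^ 3"
  assumes R: "norm I \<le> D" "0 < E"
  shows "norm (flux v (D, I) - flux v (E, 0)) \<le> (1 + sqrt 2) * norm v * norm ((D, I) - (E, 0))"
proof (cases "I = 0")
  case True
  have "flux v (D, I) - flux v (E, 0) = (0, ((D - E) / 3) *\<^sub>R v)"
    by (simp add: True flux_def stress_isotropic diff_divide_distrib scaleR_diff_left)
  then have "norm (flux v (D, I) - flux v (E, 0)) = 1 / 3 * norm v * \<bar>D - E\<bar>"
    by (simp add: norm_Pair)
  also have "\<dots> \<le> (1 + sqrt 2) * norm v * \<bar>D - E\<bar>"
    by (intro mult_right_mono) (auto intro: order_trans[of _ 1])
  finally show ?thesis by (simp add: True norm_Pair)
next
  case False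
  define J where "J = (E / norm I) *\<^sub>R I"
  have J: "norm J = E" using False R by (simp add: J_def)
  have bound: "norm (flux v (D, I) - flux v (E, s *\<^sub>R J))
      \<le> (1 + sqrt 2) * norm v * norm ((D, I) - (E, s *\<^sub>R J))" if s: "0 < s" "s < 1" for s
  proof (rule flux_lipschitz_off_axis)
    show "norm (s *\<^sub>R J) \<le> E" using s J R by (simp add: mult_left_le_one_le)
    have "(1 - u) *\<^sub>R (s *\<^sub>R J) + u *\<^sub>R I \<noteq> 0" if "0 \<le> u" "u \<le> 1" for u
    proof -
      have "0 < (1 - u) * (s * (E / norm I)) + u"
      proof (cases "u = 0")
        case True
        then show ?thesis using s R False by simp
      next
        case False
        then show ?thesis using that s R by (intro add_nonneg_pos) auto
      qed
      moreover have "(1 - u) *\<^sub>R (s *\<^sub>R J) + u *\<^sub>R I = ((1 - u) * (s * (E / norm I)) + u) *\<^sub>R I"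
        by (simp add: J_def scaleR_add_left)
      ultimately show ?thesis using False by simp
    qed
    then show "0 \<notin> closed_segment (s *\<^sub>R J) I"
      unfolding closed_segment_def mem_Collect_eq by metis
  qed (rule R(1))
  have lim: "((\<lambda>s. flux v (E, s *\<^sub>R J)) \<longlongrightarrow> flux v (E, 0)) (at_right 0)"
    using flux_continuous_along_ray[of E J v, THEN continuous_on_Icc_at_rightD] R J by simp
  show ?thesis
  proof (rule tendsto_le)
    show "((\<lambda>s. norm (flux v (D, I) - flux v (E, s *\<^sub>R J)))
        \<longlongrightarrow> norm (flux v (D, I) - flux v (E, 0))) (at_right 0)"
      by (intro tendsto_intros lim)
    show "((\<lambda>s. (1 + sqrt 2) * norm v * norm ((D, I) - (E, s *\<^sub>R J)))
        \<longlongrightarrow> (1 + sqrt 2) * norm v * norm ((D, I) - (E, 0))) (at_right 0)"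
      by (auto intro!: tendsto_eq_intros)
    show "\<forall>\<^sub>F s in at_right 0. norm (flux v (D, I) - flux v (E, s *\<^sub>R J))
        \<le> (1 + sqrt 2) * norm v * norm ((D, I) - (E, s *\<^sub>R J))"
      by (rule eventually_mono[OF eventually_at_right_real[OF zero_less_one]]) (rule bound, auto)
  qed simp
qed

text \<open>
  A segment that meets the axis is cut at the meeting point; the two partial bounds add up without
  loss because the cut point lies between the end points.
\<close>

lemma flux_lipschitz:
  assumes M: "M \<in> realizable" and M': "M' \<in> realizable"
  shows "norm (flux v M' - flux v M) \<le> (1 + sqrt 2) * norm v * norm (M' - M)"
proof -
  obtain D I D' I' where eq: "M = (D, I)" "M' = (D', I')" by (metis surj_pair)
  have R: "0 < D" "norm I \<le> D" "0 < D'" "norm I' \<le> D'"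
    using M M' by (auto simp: eq realizable_def)
  show ?thesis
  proof (cases "0 \<in> closed_segment I I'")
    case False
    then show ?thesis unfolding eq by (intro flux_lipschitz_off_axis R)
  next
    case True
    then obtain t where t: "0 \<le> t" "t \<le> 1" "0 = (1 - t) *\<^sub>R I + t *\<^sub>R I'"
      unfolding closed_segment_def by blast
    define E where "E = (1 - t) * D + t * D'"
    define L where "L = (1 + sqrt 2) * norm v"
    have E: "0 < E"
    proof (cases "t = 0")
      case False
      then show ?thesis unfolding E_def using t(1,2) R by (intro add_nonneg_pos) simp_all
    qed (use R in \<open>simp add: E_def\<close>)
    have P: "(E, 0) = (1 - t) *\<^sub>R M + t *\<^sub>R M'"
      using t(3) by (simp add: eq E_def)
    have "M - (E, 0) = (- t) *\<^sub>R (M' - M)" "M' - (E, 0) = (1 - t) *\<^sub>R (M' - M)"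
      unfolding P by (simp_all add: algebra_simps)
    then have "norm (M - (E, 0)) = t * norm (M' - M)" "norm (M' - (E, 0)) = (1 - t) * norm (M' - M)"
      using t(1,2) by (simp_all only: norm_scaleR) auto
    then have split: "norm (M - (E, 0)) + norm (M' - (E, 0)) = norm (M' - M)"
      by (simp add: algebra_simps)
    have "norm (flux v M' - flux v M) \<le> norm (flux v M' - flux v (E, 0)) + norm (flux v M - flux v (E, 0))"
      using norm_triangle_ineq4[of "flux v M' - flux v (E, 0)" "flux v M - flux v (E, 0)"] by simp
    also have "\<dots> \<le> L * norm (M' - (E, 0)) + L * norm (M - (E, 0))"
      unfolding eq L_def by (intro add_mono flux_lipschitz_to_axis R E)
    also have "\<dots> = L * norm (M' - M)"
      unfolding split[symmetric] by (simp add: algebra_simps)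
    finally show ?thesis by (simp add: L_def)
  qed
qed

section \<open>The fixed-point iteration\<close>

lemma richardson_step_eq:
  "richardson_step v lam U M = ((1 - lam) *\<^sub>R M - lam *\<^sub>R flux v M) + lam *\<^sub>R U"
  by (simp add: richardson_step_def conserved_moments_eq algebra_simps)

text \<open>
  The step adds \<open>lam * U\<close> to a vector of the closed cone. Therefore the zeroth moment stays above
  \<open>lam * fst U\<close>, and all iterates lie in a closed subset of the realizable set, away from its
  missing apex.
\<close>

lemma richardson_step_realizable:
  assumes U: "U \<in> realizable" and M: "M \<in> realizable"
    and lam: "0 < lam" "lam \<le> 1 / (1 + norm v)"
  shows "richardson_step v lam U M \<in> {M. lam * fst U \<le> fst M \<and> norm (snd M) \<le> fst M}"
proof -
  obtain D I N G where eq: "M = (D, I)" "U = (N, G)" by (metis surj_pair)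
  have R: "0 < D" "norm I \<le> D" "norm G \<le> N" using M U by (auto simp: eq realizable_def)
  have "lam * (1 + norm v) \<le> 1"
    using lam(2) by (simp add: field_simps add_pos_nonneg)
  then have "norm ((1 - lam) *\<^sub>R I - lam *\<^sub>R stress v D I) \<le> (1 - lam) * D - lam * (v \<bullet> I)"
    using R lam by (intro weighted_moments_in_cone) (auto simp: algebra_simps)
  moreover from this have "0 \<le> (1 - lam) * D - lam * (v \<bullet> I)"
    using norm_ge_zero order_trans by blast
  moreover have "norm (lam *\<^sub>R G) \<le> lam * N" using R lam by simp
  moreover have "norm ((1 - lam) *\<^sub>R I - lam *\<^sub>R stress v D I + lam *\<^sub>R G)
      \<le> norm ((1 - lam) *\<^sub>R I - lam *\<^sub>R stress v D I) + norm (lam *\<^sub>R G)"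
    by (rule norm_triangle_ineq)
  ultimately show ?thesis
    unfolding richardson_step_eq eq flux_def by (simp del: norm_scaleR)
qed

lemma richardson_step_contraction:
  assumes "M \<in> realizable" "M' \<in> realizable" and lam: "0 \<le> lam" "lam \<le> 1"
  shows "dist (richardson_step v lam U M) (richardson_step v lam U M')
    \<le> (1 - lam * (1 - (1 + sqrt 2) * norm v)) * dist M M'"
proof -
  have "richardson_step v lam U M - richardson_step v lam U M'
      = (1 - lam) *\<^sub>R (M - M') - lam *\<^sub>R (flux v M - flux v M')"
    by (simp add: richardson_step_eq algebra_simps)
  also have "norm \<dots> \<le> (1 - lam) * norm (M - M') + lam * norm (flux v M - flux v M')"
    using lam by (intro order_trans[OF norm_triangle_ineq4]) simp
  also have "\<dots> \<le> (1 - lam) * norm (M - M') + lam * ((1 + sqrt 2) * norm v * norm (M - M'))"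
    using flux_lipschitz[OF assms(2,1), of v] lam by (intro add_left_mono mult_left_mono) auto
  also have "\<dots> = (1 - lam * (1 - (1 + sqrt 2) * norm v)) * norm (M - M')"
    by (simp add: algebra_simps)
  finally show ?thesis by (simp add: dist_norm)
qed

theorem theorem2:
  fixes v :: "real ^ 3" and lam :: real and U :: "real \<times> (real ^ 3)"
  assumes "norm v < sqrt 2 - 1"
    and "0 < lam" and "lam \<le> 1" and "lam \<le> 1 / (1 + norm v)"
    and "U \<in> realizable"
  shows "\<exists>M\<in>realizable.
           U = conserved_moments v M \<and>
           (\<forall>M'\<in>realizable. U = conserved_moments v M' \<longrightarrow> M' = M) \<and>
           (\<forall>M0\<in>realizable.
              (\<forall>k. (richardson_step v lam U ^^ k) M0 \<in> realizable) \<and>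
              (\<lambda>k. (richardson_step v lam U ^^ k) M0) \<longlonglongrightarrow> M)"
proof -
  define H where "H = richardson_step v lam U"
  define S where "S = {M :: real \<times> (real ^ 3). lam * fst U \<le> fst M \<and> norm (snd M) \<le> fst M}"
  define c where "c = 1 - lam * (1 - (1 + sqrt 2) * norm v)"
  have N: "0 < fst U" using assms(5) by (auto simp: realizable_def)
  have SR: "S \<subseteq> realizable"
  proof
    fix M assume "M \<in> S"
    moreover have "0 < lam * fst U" using N assms(2) by simp
    ultimately show "M \<in> realizable" by (auto simp: S_def realizable_def case_prod_beta)
  qed
  have HS: "H M \<in> S" if "M \<in> realizable" for M
    unfolding H_def S_def by (rule richardson_step_realizable[OF assms(5) that assms(2,4)])
  have "(1 + sqrt 2) * norm v < (1 + sqrt 2) * (sqrt 2 - 1)"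
    using assms(1) by (intro mult_strict_left_mono) (auto intro: add_pos_nonneg)
  then have v1: "(1 + sqrt 2) * norm v < 1" by (simp add: algebra_simps)
  have c1: "c < 1" using v1 assms(2) by (simp add: c_def)
  have c0: "0 \<le> c"
  proof -
    have "lam * (1 - (1 + sqrt 2) * norm v) \<le> 1 * 1"
      using v1 assms(2,3) by (intro mult_mono) auto
    then show ?thesis by (simp add: c_def)
  qed
  have contr: "dist (H M) (H M') \<le> c * dist M M'" if "M \<in> realizable" "M' \<in> realizable" for M M'
    unfolding H_def c_def by (rule richardson_step_contraction[OF that]) (use assms(2,3) in auto)
  have "\<exists>!M\<in>S. H M = M"
  proof (rule Banach_fix[OF _ _ c0 c1])
    have "closed S"
      unfolding S_def by (intro closed_Collect_conj closed_Collect_le continuous_intros)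
    then show "complete S" by (simp add: complete_eq_closed)
    show "S \<noteq> {}" using HS[OF assms(5)] by auto
    show "H ` S \<subseteq> S" using HS SR by auto
    show "dist (H x) (H y) \<le> c * dist x y" if "x \<in> S" "y \<in> S" for x y
      by (rule contr) (use that SR in auto)
  qed
  then obtain M where M: "M \<in> S" "H M = M" by blast
  have MR: "M \<in> realizable" using M SR by auto
  have fixed_iff: "H M' = M' \<longleftrightarrow> U = conserved_moments v M'" for M'
    using assms(2) by (auto simp: H_def richardson_step_def)
  have unique: "M' = M" if "M' \<in> realizable" "H M' = M'" for M'
  proof (rule ccontr)
    assume "M' \<noteq> M"
    then have "c * dist M' M < 1 * dist M' M" using c1 by (intro mult_strict_right_mono) auto
    then show False using contr[OF that(1) MR] that(2) M(2) by simp
  qed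
  have iter: "(H ^^ k) M0 \<in> realizable" if "M0 \<in> realizable" for k M0
  proof (induction k)
    case (Suc k)
    then show ?case using HS[OF Suc] SR by auto
  qed (simp add: that)
  have conv: "(\<lambda>k. (H ^^ k) M0) \<longlonglongrightarrow> M" if M0: "M0 \<in> realizable" for M0
  proof -
    have bound: "dist ((H ^^ k) M0) M \<le> c ^ k * dist M0 M" for k
    proof (induction k)
      case (Suc k)
      have "dist ((H ^^ Suc k) M0) M \<le> c * dist ((H ^^ k) M0) M"
        using contr[OF iter[OF M0, of k] MR] M(2) by simp
      also have "\<dots> \<le> c * (c ^ k * dist M0 M)" using Suc c0 by (rule mult_left_mono)
      finally show ?case by simp
    qed simp
    have lim: "(\<lambda>k. c ^ k * dist M0 M) \<longlonglongrightarrow> 0"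
      by (intro tendsto_mult_left_zero LIMSEQ_realpow_zero c0 c1)
    have le: "dist ((H ^^ k) M0) M \<le> dist (c ^ k * dist M0 M) 0" for k
      using bound[of k] c0 by simp
    show ?thesis
      by (rule metric_tendsto_imp_tendsto[OF lim always_eventually]) (rule allI, rule le)
  qed
  show ?thesis
  proof (intro bexI[of _ M] conjI ballI allI impI)
    show "U = conserved_moments v M" using M(2) by (simp only: fixed_iff)
    show "M' = M" if "M' \<in> realizable" "U = conserved_moments v M'" for M'
      using unique that by (simp only: fixed_iff)
  qed (use MR iter conv in \<open>simp_all flip: H_def\<close>)
qed

end
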